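(* Let $1\leq p\leq q\leq\infty$, and let $\alpha$ be a countable ordinal. Then for every Tychonoff space $X$, the function spaces $C_p(X)$ and $B_\alpha(X)$ are $V_{(p,q)}$-barrelled. Consequently, if $X$ contains an infinite functionally bounded subset, then the space $C_p(X)$ is $V_{(p,q)}$-barrelled but not $c_0$-barrelled.
   Context: $\mathbb{F}$ denotes $\mathbb{R}$ or $\mathbb{C}$. A Tychonoff space is a completely regular $T_1$ space. $C_p(X)$ is the space of continuous $\mathbb{F}$-valued functions on $X$ with the topology of pointwise convergence. Put $B_0(X):=C_p(X)$ and, for a nonzero countable ordinal $\alpha$, let $B_\alpha(X)$ be the space of all functions $f:X\to\mathbb{F}$ that are pointwise limits of sequences from $\bigcup_{\beta<\alpha}B_\beta(X)$, with the topology of pointwise convergence inherited from $\mathbb{F}^X$. A subset $A\subseteq X$ is functionally bounded if every continuous scalar function on $X$ is bounded on $A$. For a locally convex space $E$ with topological dual $E'$: a subset $B\subseteq E'$ is equicontinuous if $B\subseteq U^\circ=\{\chi\in E':|\langle\chi,x\rangle|\le1\ \forall x\in U\}$ for some neighborhood $U$ of zero in $E$. A sequence $\{x_n\}_{n\in\omega}$ in $E$ is weakly $p$-summable if $(\langle\chi,x_n\rangle)_n\in\ell_p$ (or $\in c_0$ if $p=\infty$) for every $\chi\in E'$. A non-empty $B\subseteq E'$ is a $(p,q)$-$(V)$ set if $\big(\sup_{\chi\in B}|\langle\chi,x_n\rangle|\big)_n\in\ell_q$ (or $\in c_0$ if $q=\infty$) for every weakly $p$-summable sequence $\{x_n\}$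 in $E$. $E$ is $V_{(p,q)}$-barrelled if every $(p,q)$-$(V)$ set in $E'$ is equicontinuous; $E$ is $c_0$-barrelled if every $\sigma(E',E)$-null sequence in $E'$ is equicontinuous. *)

theory Defs
  imports "HOL-Analysis.Analysis" "HOL-Library.Function_Algebras"
begin

text \<open>
  The scalar field, real or complex, is a type of class \<^class>\<open>real_normed_field\<close>: by the
  theorems of Gelfand, Mazur and Ostrowski the reals and the complex numbers are, up to
  isometric isomorphism, the only types of this class.

  A topological vector space is given by a scalar multiplication \<open>s\<close> on a type \<open>'e\<close> of
  class \<^class>\<open>ab_group_add\<close> and a topology \<open>T\<close> whose carrier \<open>topspace T\<close> is a linear
  subspace of \<open>'e\<close>.
\<close>

locale locally_convex_space = vector_space s
  for s :: "'k::real_normed_field \<Rightarrow> 'e::ab_group_add \<Rightarrow> 'e" +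
  fixes T :: "'e topology"
  assumes subspace_topspace: "subspace (topspace T)"
    and continuous_add: "continuous_map (prod_topology T T) T (\<lambda>(x, y). x + y)"
    and continuous_scale: "continuous_map (prod_topology euclidean T) T (\<lambda>(c, x). s c x)"
    and convex_base: "\<And>U. openin T U \<Longrightarrow> 0 \<in> U \<Longrightarrow>
      \<exists>V. openin T V \<and> 0 \<in> V \<and> V \<subseteq> U \<and>
        (\<forall>x\<in>V. \<forall>y\<in>V. \<forall>t\<in>{0..1}. s (of_real (1 - t)) x + s (of_real t) y \<in> V)"

text \<open>Functionals are total functions, so they are made \<open>undefined\<close> outside the space in
  order to be determined by their values on it.\<close>

definition topological_dual ::
  "('k::real_normed_field \<Rightarrow> 'e::ab_group_add \<Rightarrow> 'e) \<Rightarrow> 'e topology \<Rightarrow> ('e \<Rightarrow> 'k) set" where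
  "topological_dual s T = {\<phi> \<in> extensional (topspace T).
     (\<forall>x\<in>topspace T. \<forall>y\<in>topspace T. \<phi> (x + y) = \<phi> x + \<phi> y) \<and>
     (\<forall>c. \<forall>x\<in>topspace T. \<phi> (s c x) = c * \<phi> x) \<and>
     continuous_map T euclidean \<phi>}"

definition polar ::
  "('k::real_normed_field \<Rightarrow> 'e::ab_group_add \<Rightarrow> 'e) \<Rightarrow> 'e topology \<Rightarrow> 'e set \<Rightarrow> ('e \<Rightarrow> 'k) set" where
  "polar s T U = {\<phi> \<in> topological_dual s T. \<forall>x\<in>U. norm (\<phi> x) \<le> 1}"

definition equicontinuous ::
  "('k::real_normed_field \<Rightarrow> 'e::ab_group_add \<Rightarrow> 'e) \<Rightarrow> 'e topology \<Rightarrow> ('e \<Rightarrow> 'k) set \<Rightarrow> bool" where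
  "equicontinuous s T B \<longleftrightarrow>
     (\<exists>U\<subseteq>topspace T. (\<exists>W. openin T W \<and> 0 \<in> W \<and> W \<subseteq> U) \<and> B \<subseteq> polar s T U)"

text \<open>The sequence space of exponent \<open>p\<close>, with the space of null sequences in the place of
  the bounded ones for \<open>p = \<infinity>\<close>.\<close>

definition lp_c0 :: "ennreal \<Rightarrow> (nat \<Rightarrow> 'k::real_normed_vector) set" where
  "lp_c0 p = {a. if p = \<infinity> then a \<longlonglongrightarrow> 0 else summable (\<lambda>n. norm (a n) powr enn2real p)}"

definition weakly_summable ::
  "('k::real_normed_field \<Rightarrow> 'e::ab_group_add \<Rightarrow> 'e) \<Rightarrow> 'e topology \<Rightarrow> ennreal \<Rightarrow> (nat \<Rightarrow> 'e) \<Rightarrow> bool" where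
  "weakly_summable s T p x \<longleftrightarrow>
     range x \<subseteq> topspace T \<and> (\<forall>\<phi>\<in>topological_dual s T. (\<lambda>n. \<phi> (x n)) \<in> lp_c0 p)"

text \<open>The condition \<^const>\<open>bdd_above\<close> says that the suprema are finite; the supremum of an
  unbounded set of reals is an unspecified real number.\<close>

definition V_set ::
  "('k::real_normed_field \<Rightarrow> 'e::ab_group_add \<Rightarrow> 'e) \<Rightarrow> 'e topology \<Rightarrow> ennreal \<Rightarrow> ennreal \<Rightarrow>
   ('e \<Rightarrow> 'k) set \<Rightarrow> bool" where
  "V_set s T p q B \<longleftrightarrow> B \<noteq> {} \<and> B \<subseteq> topological_dual s T \<and>
     (\<forall>x. weakly_summable s T p x \<longrightarrow>
        (\<forall>n. bdd_above ((\<lambda>\<phi>. norm (\<phi> (x n))) ` B)) \<and>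
        (\<lambda>n. SUP \<phi>\<in>B. norm (\<phi> (x n))) \<in> lp_c0 q)"

definition V_barrelled ::
  "('k::real_normed_field \<Rightarrow> 'e::ab_group_add \<Rightarrow> 'e) \<Rightarrow> 'e topology \<Rightarrow> ennreal \<Rightarrow> ennreal \<Rightarrow> bool" where
  "V_barrelled s T p q \<longleftrightarrow> (\<forall>B. V_set s T p q B \<longrightarrow> equicontinuous s T B)"

definition weak_star_topology ::
  "('k::real_normed_field \<Rightarrow> 'e::ab_group_add \<Rightarrow> 'e) \<Rightarrow> 'e topology \<Rightarrow> ('e \<Rightarrow> 'k) topology" where
  "weak_star_topology s T =
     subtopology (product_topology (\<lambda>_. euclidean) (topspace T)) (topological_dual s T)"

definition c0_barrelled ::
  "('k::real_normed_field \<Rightarrow> 'e::ab_group_add \<Rightarrow> 'e) \<Rightarrow> 'e topology \<Rightarrow> bool" where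
  "c0_barrelled s T \<longleftrightarrow> (\<forall>\<phi>. range \<phi> \<subseteq> topological_dual s T \<and>
     limitin (weak_star_topology s T) \<phi> (restrict (\<lambda>_. 0) (topspace T)) sequentially \<longrightarrow>
     equicontinuous s T (range \<phi>))"

definition tychonoff_space :: "'a topology \<Rightarrow> bool" where
  "tychonoff_space X \<longleftrightarrow> completely_regular_space X \<and> t1_space X"

text \<open>The scalar functions on \<open>X\<close> are represented by the functions on the whole type that
  vanish outside \<open>topspace X\<close>. They form a linear subspace, on which the topology of
  pointwise convergence on the type is that of pointwise convergence on \<open>X\<close>.\<close>

definition fun_scale :: "'k::real_normed_field \<Rightarrow> ('a \<Rightarrow> 'k) \<Rightarrow> 'a \<Rightarrow> 'k" where
  "fun_scale c f = (\<lambda>x. c * f x)"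

definition scalar_functions :: "'a topology \<Rightarrow> ('a \<Rightarrow> 'k::real_normed_field) set" where
  "scalar_functions X = {f. \<forall>x. x \<notin> topspace X \<longrightarrow> f x = 0}"

definition pointwise_topology :: "('a \<Rightarrow> 'k::real_normed_field) set \<Rightarrow> ('a \<Rightarrow> 'k) topology" where
  "pointwise_topology M = subtopology (product_topology (\<lambda>_. euclidean) UNIV) M"

definition continuous_functions :: "'a topology \<Rightarrow> ('a \<Rightarrow> 'k::real_normed_field) set" where
  "continuous_functions X = {f \<in> scalar_functions X. continuous_map X euclidean f}"

text \<open>A countable ordinal is represented by a well-order on a set of natural numbers whose order
  type it is. The smaller ordinals are the well-orders below it in \<^const>\<open>ordLess\<close>, and
  the ordinal zero is the empty relation.\<close>

function baire_functions :: "'a topology \<Rightarrow> nat rel \<Rightarrow> ('a \<Rightarrow> 'k::real_normed_field) set" where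
  "baire_functions X \<alpha> =
     (if \<alpha> = {} then continuous_functions X
      else {f \<in> scalar_functions X. \<exists>g.
              range g \<subseteq> (\<Union>\<beta>\<in>{\<beta>. (\<beta>, \<alpha>) \<in> ordLess}. baire_functions X \<beta>) \<and>
              (\<forall>x\<in>topspace X. (\<lambda>n. g n x) \<longlonglongrightarrow> f x)})"
  by pat_completeness auto
termination
  by (relation "inv_image ordLess snd") (auto intro: wf_ordLess)

declare baire_functions.simps [simp del]

definition Cp :: "'a topology \<Rightarrow> ('a \<Rightarrow> 'k::real_normed_field) topology" where
  "Cp X = pointwise_topology (continuous_functions X)"

definition Baire :: "'a topology \<Rightarrow> nat rel \<Rightarrow> ('a \<Rightarrow> 'k::real_normed_field) topology" where
  "Baire X \<alpha> = pointwise_topology (baire_functions X \<alpha>)"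

definition functionally_bounded :: "'k::real_normed_field itself \<Rightarrow> 'a topology \<Rightarrow> 'a set \<Rightarrow> bool" where
  "functionally_bounded _ X A \<longleftrightarrow> A \<subseteq> topspace X \<and>
     (\<forall>f :: 'a \<Rightarrow> 'k. continuous_map X euclidean f \<longrightarrow> bounded (f ` A))"

text \<open>The function spaces are locally convex, so that the notions above apply to them.\<close>

interpretation fun_scale: vector_space "fun_scale :: 'k::real_normed_field \<Rightarrow> ('a \<Rightarrow> 'k) \<Rightarrow> 'a \<Rightarrow> 'k"
  by unfold_locales (auto simp: fun_scale_def fun_eq_iff algebra_simps)

lemma continuous_map_mult_scalar:
  fixes f g :: "'a \<Rightarrow> 'k::real_normed_field"
  assumes "continuous_map X euclidean f" "continuous_map X euclidean g"
  shows "continuous_map X euclidean (\<lambda>x. f x * g x)"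
  using assms by (simp add: continuous_map_atin tendsto_mult)

lemma subspace_continuous_functions: "fun_scale.subspace (continuous_functions X)"
  unfolding fun_scale.subspace_def continuous_functions_def scalar_functions_def fun_scale_def
    zero_fun_def plus_fun_def
  by (auto intro: continuous_map_add continuous_map_mult_scalar)

lemma not_ordLess_empty: "(\<beta> :: nat rel, {} :: nat rel) \<notin> ordLess"
proof
  assume a: "(\<beta>, {} :: nat rel) \<in> ordLess"
  then have "Well_order \<beta>" "Well_order ({} :: nat rel)"
    by (auto simp: ordLess_def)
  moreover from this have "embed ({} :: nat rel) \<beta> f" for f
    by (simp add: embed_def)
  ultimately have "({} :: nat rel, \<beta>) \<in> ordLeq"
    by (auto simp: ordLeq_def)
  with a show False
    using not_ordLess_ordLeq by blast
qed

lemma empty_ordLess: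
  assumes "Well_order \<alpha>" "\<alpha> \<noteq> {}"
  shows "({} :: nat rel, \<alpha> :: nat rel) \<in> ordLess"
proof (rule ccontr)
  assume "({} :: nat rel, \<alpha>) \<notin> ordLess"
  then have "(\<alpha>, {} :: nat rel) \<in> ordLeq"
    using assms(1) not_ordLess_iff_ordLeq[of \<alpha> "{} :: nat rel"] by simp
  then obtain f where "embed \<alpha> ({} :: nat rel) f"
    by (auto simp: ordLeq_def)
  then have "f ` Field \<alpha> \<subseteq> Field ({} :: nat rel)"
    using assms(1) embed_Field by blast
  then show False
    using assms(2) by (auto simp: Field_def)
qed

lemma baire_functions_mono:
  assumes "(\<beta>, \<gamma>) \<in> ordLeq"
  shows "baire_functions X \<beta> \<subseteq> baire_functions X \<gamma>"
proof -
  have wo: "Well_order \<beta>" "Well_order \<gamma>"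
    using assms by (auto simp: ordLeq_def)
  consider "(\<beta>, \<gamma>) \<in> ordLess" | "(\<beta>, \<gamma>) \<in> ordIso"
    using assms ordLeq_iff_ordLess_or_ordIso by blast
  then show ?thesis
  proof cases
    case 1
    then have "\<gamma> \<noteq> {}"
      using not_ordLess_empty by blast
    show ?thesis
    proof
      fix f assume f: "f \<in> baire_functions X \<beta>"
      then have "f \<in> scalar_functions X"
        by (subst (asm) baire_functions.simps) (auto simp: continuous_functions_def split: if_splits)
      moreover have "range (\<lambda>n::nat. f) \<subseteq> (\<Union>\<beta>\<in>{\<beta>. (\<beta>, \<gamma>) \<in> ordLess}. baire_functions X \<beta>)"
        using f 1 by auto
      ultimately show "f \<in> baire_functions X \<gamma>"
        using \<open>\<gamma> \<noteq> {}\<close>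
        by (subst baire_functions.simps) (auto intro!: exI[of _ "\<lambda>n. f"])
    qed
  next
    case 2
    then have "(\<delta>, \<beta>) \<in> ordLess \<longleftrightarrow> (\<delta>, \<gamma>) \<in> ordLess" for \<delta> :: "nat rel"
      using ordLess_ordIso_trans ordIso_symmetric by blast
    moreover from this have "\<beta> = {} \<longleftrightarrow> \<gamma> = {}"
      using empty_ordLess wo not_ordLess_empty by blast
    ultimately show ?thesis
      by (subst (1 2) baire_functions.simps) simp
  qed
qed

lemma subspace_baire_functions:
  assumes "Well_order \<alpha>"
  shows "fun_scale.subspace (baire_functions X \<alpha> :: ('a \<Rightarrow> 'k::real_normed_field) set)"
  using assms
proof (induction \<alpha> rule: wf_induct_rule[OF wf_ordLess])
  case (1 \<alpha>)
  let ?B = "baire_functions X :: nat rel \<Rightarrow> ('a \<Rightarrow> 'k) set"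
  let ?U = "\<Union>\<beta>\<in>{\<beta>. (\<beta>, \<alpha>) \<in> ordLess}. ?B \<beta>"
  show ?case
  proof (cases "\<alpha> = {}")
    case True
    then show ?thesis
      by (subst baire_functions.simps) (simp add: subspace_continuous_functions)
  next
    case False
    have B: "?B \<alpha> = {f \<in> scalar_functions X. \<exists>g. range g \<subseteq> ?U \<and>
        (\<forall>x\<in>topspace X. (\<lambda>n. g n x) \<longlonglongrightarrow> f x)}"
      using False by (subst baire_functions.simps) simp
    have sub: "fun_scale.subspace (?B \<beta>)" if "(\<beta>, \<alpha>) \<in> ordLess" for \<beta>
    proof -
      have "Well_order \<beta>"
        using that by (simp add: ordLess_def)
      with 1(1)[OF that] show ?thesis .
    qed
    have U0: "0 \<in> ?U"
      using empty_ordLess[OF 1(2) False] fun_scale.subspace_0[OF sub] by (intro UN_I) simp_all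
    have Uadd: "u + v \<in> ?U" if "u \<in> ?U" "v \<in> ?U" for u v
    proof -
      from that obtain \<beta> \<gamma> where *: "(\<beta>, \<alpha>) \<in> ordLess" "u \<in> ?B \<beta>" "(\<gamma>, \<alpha>) \<in> ordLess" "v \<in> ?B \<gamma>"
        by blast
      then have "Well_order \<beta>" "Well_order \<gamma>"
        by (auto simp: ordLess_def)
      then have "(\<beta>, \<gamma>) \<in> ordLeq \<or> (\<gamma>, \<beta>) \<in> ordLeq"
        using ordLess_or_ordLeq ordLess_imp_ordLeq by blast
      then show ?thesis
      proof
        assume "(\<beta>, \<gamma>) \<in> ordLeq"
        then have "?B \<beta> \<subseteq> ?B \<gamma>"
          by (rule baire_functions_mono)
        with * have "u \<in> ?B \<gamma>" "v \<in> ?B \<gamma>"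
          by (simp_all add: subset_iff)
        then have "u + v \<in> ?B \<gamma>"
          using * by (intro fun_scale.subspace_add sub)
        then show ?thesis
          using * by (intro UN_I[of \<gamma>]) simp_all
      next
        assume "(\<gamma>, \<beta>) \<in> ordLeq"
        then have "?B \<gamma> \<subseteq> ?B \<beta>"
          by (rule baire_functions_mono)
        with * have "u \<in> ?B \<beta>" "v \<in> ?B \<beta>"
          by (simp_all add: subset_iff)
        then have "u + v \<in> ?B \<beta>"
          using * by (intro fun_scale.subspace_add sub)
        then show ?thesis
          using * by (intro UN_I[of \<beta>]) simp_all
      qed
    qed
    have Uscale: "fun_scale c u \<in> ?U" if u: "u \<in> ?U" for c u
    proof -
      from u obtain \<beta> where "(\<beta>, \<alpha>) \<in> ordLess" "u \<in> ?B \<beta>"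
        by blast
      then show ?thesis
        by (intro UN_I[of \<beta>] fun_scale.subspace_scale sub) simp_all
    qed
    show ?thesis
    proof (rule fun_scale.subspaceI)
      show "0 \<in> ?B \<alpha>"
        unfolding B mem_Collect_eq
      proof (intro conjI exI[of _ "\<lambda>n. 0"])
        show "range (\<lambda>n::nat. 0) \<subseteq> ?U"
          using U0 by (rule image_subsetI)
      qed (simp_all add: scalar_functions_def)
    next
      fix f h assume "f \<in> ?B \<alpha>" "h \<in> ?B \<alpha>"
      then obtain u v where *: "f \<in> scalar_functions X" "h \<in> scalar_functions X"
          "range u \<subseteq> ?U" "range v \<subseteq> ?U"
          "\<forall>x\<in>topspace X. (\<lambda>n. u n x) \<longlonglongrightarrow> f x" "\<forall>x\<in>topspace X. (\<lambda>n. v n x) \<longlonglongrightarrow> h x"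
        unfolding B by blast
      have "range (\<lambda>n. u n + v n) \<subseteq> ?U"
        using Uadd[OF subsetD[OF *(3) rangeI] subsetD[OF *(4) rangeI]] by (rule image_subsetI)
      moreover have "\<forall>x\<in>topspace X. (\<lambda>n. (u n + v n) x) \<longlonglongrightarrow> (f + h) x"
        using *(5,6) by (auto intro: tendsto_add)
      moreover have "f + h \<in> scalar_functions X"
        using *(1,2) by (auto simp: scalar_functions_def)
      ultimately show "f + h \<in> ?B \<alpha>"
        unfolding B by blast
    next
      fix c f assume "f \<in> ?B \<alpha>"
      then obtain u where *: "f \<in> scalar_functions X" "range u \<subseteq> ?U"
          "\<forall>x\<in>topspace X. (\<lambda>n. u n x) \<longlonglongrightarrow> f x"
        unfolding B by blast
      have "range (\<lambda>n. fun_scale c (u n)) \<subseteq> ?U"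
        using Uscale[OF subsetD[OF *(2) rangeI]] by (rule image_subsetI)
      moreover have "\<forall>x\<in>topspace X. (\<lambda>n. fun_scale c (u n) x) \<longlonglongrightarrow> fun_scale c f x"
        using *(3) by (auto simp: fun_scale_def intro: tendsto_mult_left)
      moreover have "fun_scale c f \<in> scalar_functions X"
        using *(1) by (auto simp: scalar_functions_def fun_scale_def)
      ultimately show "fun_scale c f \<in> ?B \<alpha>"
        unfolding B by blast
    qed
  qed
qed

lemma locally_convex_space_pointwise_topology:
  fixes M :: "('a \<Rightarrow> 'k::real_normed_field) set"
  assumes M: "fun_scale.subspace M"
  shows "locally_convex_space fun_scale (pointwise_topology M)"
proof (intro locally_convex_space.intro locally_convex_space_axioms.intro)
  let ?T = "pointwise_topology M"
  show "vector_space (fun_scale :: 'k \<Rightarrow> ('a \<Rightarrow> 'k) \<Rightarrow> 'a \<Rightarrow> 'k)"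
    by unfold_locales
  have top: "topspace ?T = M"
    by (simp add: pointwise_topology_def)
  show "module.subspace fun_scale (topspace ?T)"
    using M top by simp
  have ev: "continuous_map ?T euclidean (\<lambda>f. f a)" for a
    unfolding pointwise_topology_def
    by (intro continuous_map_from_subtopology) (auto intro: continuous_map_product_projection)
  have into: "continuous_map S ?T h"
    if "h \<in> topspace S \<rightarrow> M" "\<And>a. continuous_map S euclidean (\<lambda>z. h z a)" for S :: "'z topology" and h
    unfolding pointwise_topology_def continuous_map_in_subtopology
    using that by (auto simp: continuous_map_componentwise_UNIV)
  show "continuous_map (prod_topology ?T ?T) ?T (\<lambda>(x, y). x + y)"
  proof (rule into)
    show "(\<lambda>(x, y). x + y) \<in> topspace (prod_topology ?T ?T) \<rightarrow> M"
      using fun_scale.subspace_add[OF M] by (auto simp: top)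
    show "continuous_map (prod_topology ?T ?T) euclidean (\<lambda>z. (case z of (x, y) \<Rightarrow> x + y) a)" for a
      using continuous_map_add[OF
          continuous_map_compose[OF continuous_map_fst ev[of a], unfolded o_def]
          continuous_map_compose[OF continuous_map_snd ev[of a], unfolded o_def]]
      by (simp add: case_prod_unfold)
  qed
  show "continuous_map (prod_topology euclidean ?T) ?T (\<lambda>(c, x). fun_scale c x)"
  proof (rule into)
    show "(\<lambda>(c, x). fun_scale c x) \<in> topspace (prod_topology euclidean ?T) \<rightarrow> M"
      using fun_scale.subspace_scale[OF M] by (auto simp: top)
    have "continuous_map (prod_topology euclidean ?T) euclidean (\<lambda>z. fst z * snd z a)" for a
      using continuous_map_compose[OF continuous_map_snd ev[of a], unfolded o_def]
      by (intro continuous_map_mult_scalar continuous_map_fst)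
    then show "continuous_map (prod_topology euclidean ?T) euclidean
        (\<lambda>z. (case z of (c, x) \<Rightarrow> fun_scale c x) a)" for a
      by (simp add: case_prod_unfold fun_scale_def)
  qed
  fix U assume "openin ?T U" "0 \<in> U"
  then obtain W where W: "openin (product_topology (\<lambda>_. euclidean) UNIV) W" "U = W \<inter> M"
    by (auto simp: pointwise_topology_def openin_subtopology)
  with \<open>0 \<in> U\<close> obtain D where D: "finite {i. D i \<noteq> (UNIV :: 'k set)}" "\<And>i. open (D i)"
      "0 \<in> Pi\<^sub>E UNIV D" "Pi\<^sub>E UNIV D \<subseteq> W"
    by (fastforce simp: openin_product_topology_alt)
  have "\<exists>e. \<forall>i. e i > 0 \<and> ball (0 :: 'k) (e i) \<subseteq> D i"
    using D(2,3) by (intro choice) (force simp: open_contains_ball PiE_iff)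
  then obtain e where e: "\<And>i. e i > 0" "\<And>i. ball 0 (e i) \<subseteq> D i"
    by metis
  define D' where "D' i = (if D i = UNIV then UNIV else ball (0 :: 'k) (e i))" for i
  define V where "V = Pi\<^sub>E UNIV D' \<inter> M"
  have "openin (product_topology (\<lambda>_. euclidean) UNIV) (Pi\<^sub>E UNIV D')"
    unfolding openin_PiE_gen
    by (intro disjI2 conjI ballI finite_subset[OF _ D(1)]) (auto simp: D'_def)
  then have "openin ?T V"
    by (auto simp: V_def pointwise_topology_def openin_subtopology)
  moreover have "0 \<in> V"
    using e(1) fun_scale.subspace_0[OF M] by (auto simp: V_def D'_def)
  moreover have "V \<subseteq> U"
  proof -
    have "Pi\<^sub>E UNIV D' \<subseteq> Pi\<^sub>E UNIV D"
      using e(2) by (intro PiE_mono) (auto simp: D'_def)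
    then show ?thesis
      using D(4) W(2) by (auto simp: V_def)
  qed
  moreover have "fun_scale (of_real (1 - t)) x + fun_scale (of_real t) y \<in> V"
    if "x \<in> V" "y \<in> V" "t \<in> {0..1}" for x y t
  proof -
    have "of_real (1 - t) * x i + of_real t * y i \<in> D' i" for i
    proof -
      have "x i \<in> D' i" "y i \<in> D' i"
        using that by (auto simp: V_def PiE_iff)
      moreover have "convex (D' i)"
        by (simp add: D'_def)
      ultimately have "(1 - t) *\<^sub>R x i + t *\<^sub>R y i \<in> D' i"
        using that(3) by (intro convexD) auto
      then show ?thesis
        by (simp only: scaleR_conv_of_real)
    qed
    moreover have "fun_scale (of_real (1 - t)) x + fun_scale (of_real t) y \<in> M"
      using that by (intro fun_scale.subspace_add[OF M] fun_scale.subspace_scale[OF M])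
        (auto simp: V_def)
    ultimately show ?thesis
      by (auto simp: V_def PiE_iff fun_scale_def)
  qed
  ultimately show "\<exists>V. openin ?T V \<and> 0 \<in> V \<and> V \<subseteq> U \<and>
      (\<forall>x\<in>V. \<forall>y\<in>V. \<forall>t\<in>{0..1}. fun_scale (of_real (1 - t)) x + fun_scale (of_real t) y \<in> V)"
    by blast
qed

lemma locally_convex_space_Cp: "locally_convex_space fun_scale (Cp X)"
  unfolding Cp_def
  by (intro locally_convex_space_pointwise_topology subspace_continuous_functions)

lemma locally_convex_space_Baire:
  "Well_order \<alpha> \<Longrightarrow> locally_convex_space fun_scale (Baire X \<alpha>)"
  unfolding Baire_def
  by (intro locally_convex_space_pointwise_topology subspace_baire_functions)

end

theory Submission
  imports Defs
begin

text \<open>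
  Let \<open>M\<close> be a linear space of functions on \<open>X\<close> that contains all continuous ones, with the
  topology of pointwise convergence. A continuous functional on \<open>M\<close> sees only the values at
  finitely many points, and a smallest set of such points serves as its support. Everything
  rests on the fact that the supports of the elements of a set of type \<open>(p,q)-(V)\<close> have a finite
  union.

  If the union of the supports were infinite, a Hausdorff argument would give points
  \<open>z\<^sub>0, z\<^sub>1, \<dots>\<close> in it with pairwise disjoint neighbourhoods. For a functional \<open>\<phi>\<^sub>n\<close> whose support
  contains \<open>z\<^sub>n\<close>, complete regularity yields a continuous function \<open>h\<^sub>n\<close> that lives near \<open>z\<^sub>n\<close>, away
  from the rest of the support, and is scaled so that \<open>\<phi>\<^sub>n(h\<^sub>n) = 1\<close>. As the \<open>h\<^sub>n\<close> have disjoint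
  carriers, each point, and hence each continuous functional, annihilates all but finitely
  many of them, so they are weakly \<open>p\<close>-summable for trivial reasons. But the suprema over the
  set are at least \<open>1\<close> at every \<open>h\<^sub>n\<close>, so they are neither null nor \<open>q\<close>-summable.

  Once the union \<open>S\<close> of the supports is finite, a function is seen only through its values on
  \<open>S\<close>. Interpolating these by finitely many continuous functions, on each of which the
  functionals are bounded, gives a neighbourhood of zero on which all functionals are bounded
  by \<open>1\<close>. The spaces of the theorem are instances of \<open>M\<close>.

  For the failure of \<open>c\<^sub>0\<close>-barrelledness, take distinct points \<open>a\<^sub>n\<close> of an infinite functionally
  bounded set. The scaled evaluations \<open>f \<mapsto> f(a\<^sub>n) / (n + 1)\<close> are weak-star null because every
  continuous function is bounded on the set, but infinitely many points are involved, which
  equicontinuity excludes.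
\<close>

section \<open>Separation in Tychonoff spaces\<close>

lemma tychonoff_bump:
  assumes "tychonoff_space X" "openin X U" "x \<in> U"
  obtains h :: "'a \<Rightarrow> 'k::real_normed_field"
  where "h \<in> continuous_functions X" "h x = 1" "\<And>y. y \<notin> U \<Longrightarrow> h y = 0"
proof -
  have UX: "U \<subseteq> topspace X"
    using assms(2) by (rule openin_subset)
  have "closedin X (topspace X - U) \<and> x \<in> topspace X - (topspace X - U)"
    using assms(2,3) UX by blast
  then obtain f :: "'a \<Rightarrow> real" where f: "continuous_map X (top_of_set {0..1}) f" "f x = 0"
      "f ` (topspace X - U) \<subseteq> {1}"
    using assms(1) unfolding tychonoff_space_def completely_regular_space_def by blast
  define h :: "'a \<Rightarrow> 'k" where "h y = (if y \<in> topspace X then of_real (1 - f y) else 0)" for y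
  have "continuous_map X euclidean f"
    using f(1) by (simp add: continuous_map_in_subtopology)
  then have "continuous_map X euclidean (\<lambda>y. of_real (1 - f y) :: 'k)"
    by (simp add: continuous_map_atin tendsto_diff tendsto_of_real)
  then have "continuous_map X euclidean h"
    by (rule continuous_map_eq) (simp add: h_def)
  then have "h \<in> continuous_functions X"
    by (simp add: continuous_functions_def scalar_functions_def h_def)
  moreover have "h x = 1"
    using f(2) UX assms(3) by (auto simp: h_def)
  moreover have "h y = 0" if "y \<notin> U" for y
    using f(3) that by (auto simp: h_def)
  ultimately show thesis
    by (rule that)
qed

lemma tychonoff_openin_diff_finite:
  assumes "tychonoff_space X" "openin X U" "finite F" "F \<subseteq> topspace X"
  shows "openin X (U - F)"
  using assms by (intro openin_diff) (auto simp: tychonoff_space_def t1_space_closedin_finite)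

lemma tychonoff_bump_finite:
  assumes "tychonoff_space X" "finite F" "F \<subseteq> topspace X" "x \<in> topspace X" "x \<notin> F"
  obtains h :: "'a \<Rightarrow> 'k::real_normed_field"
  where "h \<in> continuous_functions X" "h x = 1" "\<And>y. y \<in> F \<Longrightarrow> h y = 0"
proof (rule tychonoff_bump[OF assms(1) tychonoff_openin_diff_finite[OF assms(1) openin_topspace assms(2,3)]])
  show "x \<in> topspace X - F"
    using assms(4,5) by blast
qed (use that in blast)

text \<open>A function that separates two points of \<open>S \<inter> W\<close> covers \<open>W\<close> by two open sets, each of
  which misses a neighbourhood of one of the two points. One of the two sets still has
  infinitely many points of \<open>S\<close>, and the step can be repeated in it.\<close>

lemma tychonoff_split_infinite:
  assumes X: "tychonoff_space X" and W: "openin X W" and inf: "infinite (S \<inter> W)"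
  obtains x V W' where "x \<in> S" "x \<in> V" "openin X V" "V \<subseteq> W" "openin X W'" "W' \<subseteq> W"
    "V \<inter> W' = {}" "infinite (S \<inter> W')"
proof -
  obtain a where a: "a \<in> S \<inter> W"
    using infinite_imp_nonempty[OF inf] by blast
  have "infinite (S \<inter> W - {a})"
    using inf by simp
  then obtain b where b: "b \<in> S \<inter> W" "b \<noteq> a"
    using infinite_imp_nonempty by blast
  have WX: "W \<subseteq> topspace X"
    using W by (rule openin_subset)
  obtain f :: "'a \<Rightarrow> real" where f: "f \<in> continuous_functions X" "f b = 1"
      and "\<And>y. y \<in> {a} \<Longrightarrow> f y = 0"
    by (rule tychonoff_bump_finite[OF X, of "{a}" b]) (use a b WX in auto)
  then have fa: "f a = 0"
    by simp
  have cont: "continuous_map X euclidean f"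
    using f(1) by (simp add: continuous_functions_def)
  have op: "openin X {x \<in> W. f x \<in> D}" if "open D" for D
  proof -
    have "openin X {x \<in> topspace X. f x \<in> D}"
      using cont that by (simp add: openin_continuous_map_preimage)
    then have "openin X (W \<inter> {x \<in> topspace X. f x \<in> D})"
      using W by blast
    also have "W \<inter> {x \<in> topspace X. f x \<in> D} = {x \<in> W. f x \<in> D}"
      using WX by blast
    finally show ?thesis .
  qed
  have "S \<inter> W \<subseteq> S \<inter> {x \<in> W. f x \<in> {..<2/3}} \<union> S \<inter> {x \<in> W. f x \<in> {1/3<..}}"
    by auto
  then have "infinite (S \<inter> {x \<in> W. f x \<in> {..<2/3}} \<union> S \<inter> {x \<in> W. f x \<in> {1/3<..}})"
    using inf by (rule infinite_super)
  then consider "infinite (S \<inter> {x \<in> W. f x \<in> {..<2/3}})" | "infinite (S \<inter> {x \<in> W. f x \<in> {1/3<..}})"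
    unfolding finite_Un by blast
  then show thesis
  proof cases
    case 1
    show thesis
      by (rule that[of b "{x \<in> W. f x \<in> {2/3<..}}" "{x \<in> W. f x \<in> {..<2/3}}"])
        (use 1 b f(2) op[of "{2/3<..}"] op[of "{..<2/3}"] in auto)
  next
    case 2
    show thesis
      by (rule that[of a "{x \<in> W. f x \<in> {..<1/3}}" "{x \<in> W. f x \<in> {1/3<..}}"])
        (use 2 a fa op[of "{..<1/3}"] op[of "{1/3<..}"] in auto)
  qed
qed

lemma tychonoff_disjoint_neighbourhoods:
  assumes X: "tychonoff_space X" and S: "infinite S" "S \<subseteq> topspace X"
  obtains z :: "nat \<Rightarrow> 'a" and V where "\<And>n. z n \<in> S" "\<And>n. z n \<in> V n" "\<And>n. openin X (V n)"
    "disjoint_family V"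
proof -
  define P where "P W \<longleftrightarrow> openin X W \<and> infinite (S \<inter> W)" for W
  \<comment> \<open>The state of the recursion is the point just chosen, its neighbourhood, and the open set
    in which the construction goes on.\<close>
  have "\<exists>g :: nat \<Rightarrow> 'a \<times> 'a set \<times> 'a set. \<forall>n. P (snd (snd (g n))) \<and>
      (case (g n, g (Suc n)) of ((_, _, W), (x, V, W')) \<Rightarrow>
        x \<in> S \<and> x \<in> V \<and> openin X V \<and> V \<subseteq> W \<and> W' \<subseteq> W \<and> V \<inter> W' = {})"
  proof (rule dependent_nat_choice)
    have "P (topspace X)"
      using S by (simp add: P_def inf.absorb1)
    then show "\<exists>t :: 'a \<times> 'a set \<times> 'a set. P (snd (snd t))"
      by (intro exI[of _ "(undefined, {}, topspace X)"]) simp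
  next
    fix t :: "'a \<times> 'a set \<times> 'a set" and n :: nat
    assume "P (snd (snd t))"
    then have "openin X (snd (snd t))" "infinite (S \<inter> snd (snd t))"
      by (simp_all add: P_def)
    then obtain x V W' where "x \<in> S" "x \<in> V" "openin X V" "V \<subseteq> snd (snd t)" "openin X W'"
        "W' \<subseteq> snd (snd t)" "V \<inter> W' = {}" "infinite (S \<inter> W')"
      by (rule tychonoff_split_infinite[OF X])
    then show "\<exists>t'. P (snd (snd t')) \<and> (case (t, t') of ((_, _, W), (x, V, W')) \<Rightarrow>
        x \<in> S \<and> x \<in> V \<and> openin X V \<and> V \<subseteq> W \<and> W' \<subseteq> W \<and> V \<inter> W' = {})"
      by (intro exI[of _ "(x, V, W')"]) (auto simp: P_def split: prod.splits)
  qed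
  then obtain g :: "nat \<Rightarrow> 'a \<times> 'a set \<times> 'a set" where g: "\<forall>n. P (snd (snd (g n))) \<and>
      (case (g n, g (Suc n)) of ((_, _, W), (x, V, W')) \<Rightarrow>
        x \<in> S \<and> x \<in> V \<and> openin X V \<and> V \<subseteq> W \<and> W' \<subseteq> W \<and> V \<inter> W' = {})" ..
  define z where "z n = fst (g (Suc n))" for n
  define V where "V n = fst (snd (g (Suc n)))" for n
  define W where "W n = snd (snd (g n))" for n
  have step: "z n \<in> S" "z n \<in> V n" "openin X (V n)" "V n \<subseteq> W n" "W (Suc n) \<subseteq> W n"
    "V n \<inter> W (Suc n) = {}" for n
    using g[rule_format, of n] by (auto simp: z_def V_def W_def split: prod.splits)
  have W: "W m \<subseteq> W n" if "n \<le> m" for m n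
    using step(5) that by (rule lift_Suc_antimono_le)
  have "V m \<inter> V n = {}" if "m < n" for m n
    using step(4)[of n] step(6)[of m] W[of "Suc m" n] that by (simp add: Suc_le_eq) blast
  then have "disjoint_family V"
    unfolding disjoint_family_on_def by (metis Int_commute linorder_neqE_nat)
  with step show thesis
    by (intro that)
qed

section \<open>Continuous functionals for pointwise convergence\<close>

lemma topspace_pointwise_topology [simp]: "topspace (pointwise_topology M) = M"
  by (simp add: pointwise_topology_def)

lemma continuous_map_pointwise_eval:
  "continuous_map (pointwise_topology M) euclidean (\<lambda>f. f x)"
  unfolding pointwise_topology_def
  by (intro continuous_map_from_subtopology) (auto intro: continuous_map_product_projection)

lemma openin_pointwise_basic:
  assumes "finite F"
  shows "openin (pointwise_topology M) {f \<in> M. \<forall>x\<in>F. norm (f x) < e}"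
proof -
  have "openin (pointwise_topology M) {f \<in> M. norm (f x) < e}" for x
  proof -
    have "openin (pointwise_topology M) {f \<in> topspace (pointwise_topology M). f x \<in> ball 0 e}"
      by (rule openin_continuous_map_preimage[OF continuous_map_pointwise_eval]) simp
    then show ?thesis
      by simp
  qed
  then have "openin (pointwise_topology M)
      (topspace (pointwise_topology M) \<inter> (\<Inter>x\<in>F. {f \<in> M. norm (f x) < e}))"
    using assms by (intro openin_Int_Inter) (use openin_topspace[of "pointwise_topology M"] in auto)
  also have "topspace (pointwise_topology M) \<inter> (\<Inter>x\<in>F. {f \<in> M. norm (f x) < e}) =
      {f \<in> M. \<forall>x\<in>F. norm (f x) < e}"
    by auto
  finally show ?thesis .
qed

lemma pointwise_zero_neighbourhood:
  fixes M :: "('a \<Rightarrow> 'k::real_normed_field) set"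
  assumes "openin (pointwise_topology M) U" "0 \<in> U"
  obtains F e where "finite F" "e > 0" "\<And>f. f \<in> M \<Longrightarrow> (\<And>x. x \<in> F \<Longrightarrow> norm (f x) < e) \<Longrightarrow> f \<in> U"
proof -
  obtain W where W: "openin (product_topology (\<lambda>_. euclidean) UNIV) W" "U = W \<inter> M"
    using assms(1) by (auto simp: pointwise_topology_def openin_subtopology)
  with \<open>0 \<in> U\<close> obtain D where D: "finite {i. D i \<noteq> (UNIV :: 'k set)}" "\<And>i. open (D i)"
      "0 \<in> Pi\<^sub>E UNIV D" "Pi\<^sub>E UNIV D \<subseteq> W"
    by (fastforce simp: openin_product_topology_alt)
  define F where "F = {i. D i \<noteq> UNIV}"
  have "\<forall>\<^sub>F e in at_right 0. \<forall>i\<in>F. ball 0 e \<subseteq> D i"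
  proof (rule eventually_ball_finite)
    show "\<forall>i\<in>F. \<forall>\<^sub>F e in at_right 0. ball 0 e \<subseteq> D i"
    proof
      fix i
      have "0 \<in> D i"
        using D(3) by auto
      then obtain d where "d > 0" "ball 0 d \<subseteq> D i"
        using D(2) open_contains_ball by blast
      then show "\<forall>\<^sub>F e in at_right 0. ball 0 e \<subseteq> D i"
        unfolding eventually_at_right_field
        by (intro exI[of _ d]) (meson dual_order.trans less_imp_le subset_ball)
    qed
  qed (use D(1) in \<open>simp add: F_def\<close>)
  then obtain e :: real where e: "e > 0" "\<And>i. i \<in> F \<Longrightarrow> ball 0 e \<subseteq> D i"
    unfolding eventually_at_right_field by (metis dense)
  show thesis
  proof (rule that[of F e])
    fix f assume f: "f \<in> M" "\<And>x. x \<in> F \<Longrightarrow> norm (f x) < e"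
    have "f i \<in> D i" for i
      using e(2)[of i] f(2)[of i] by (cases "i \<in> F") (auto simp: F_def)
    then show "f \<in> U"
      using D(4) f(1) W(2) by (auto simp: PiE_iff)
  qed (use D(1) e(1) in \<open>simp_all add: F_def\<close>)
qed

definition determining_set :: "('a \<Rightarrow> 'k::zero) set \<Rightarrow> (('a \<Rightarrow> 'k) \<Rightarrow> 'k) \<Rightarrow> 'a set \<Rightarrow> bool" where
  "determining_set M \<phi> F \<longleftrightarrow> (\<forall>f\<in>M. (\<forall>x\<in>F. f x = 0) \<longrightarrow> \<phi> f = 0)"

lemma topological_dualD:
  assumes "\<phi> \<in> topological_dual fun_scale (pointwise_topology M)"
  shows "f \<in> M \<Longrightarrow> g \<in> M \<Longrightarrow> \<phi> (f + g) = \<phi> f + \<phi> g"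
    and "f \<in> M \<Longrightarrow> \<phi> (fun_scale c f) = c * \<phi> f"
    and "continuous_map (pointwise_topology M) euclidean \<phi>"
  using assms by (auto simp: topological_dual_def)

lemma topological_dual_zero:
  assumes "\<phi> \<in> topological_dual fun_scale (pointwise_topology M)" "fun_scale.subspace M"
  shows "\<phi> 0 = 0"
  using topological_dualD(2)[OF assms(1) fun_scale.subspace_0[OF assms(2)], of 0] by simp

lemma topological_dual_diff:
  assumes "\<phi> \<in> topological_dual fun_scale (pointwise_topology M)" "fun_scale.subspace M"
    "f \<in> M" "g \<in> M"
  shows "\<phi> (f - g) = \<phi> f - \<phi> g"
  using topological_dualD(1)[OF assms(1), of "f - g" g] assms fun_scale.subspace_diff
  by (metis add_diff_cancel_right' diff_add_cancel)

lemma topological_dual_sum: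
  assumes "\<phi> \<in> topological_dual fun_scale (pointwise_topology M)" "fun_scale.subspace M"
    "\<And>i. i \<in> I \<Longrightarrow> f i \<in> M"
  shows "\<phi> (sum f I) = (\<Sum>i\<in>I. \<phi> (f i))"
  using assms(3)
proof (induction I rule: infinite_finite_induct)
  case (insert i I)
  then have "f i \<in> M" "sum f I \<in> M" "\<phi> (sum f I) = (\<Sum>i\<in>I. \<phi> (f i))"
    using fun_scale.subspace_sum[OF assms(2), of I f] by auto
  then show ?case
    by (simp only: sum.insert[OF insert(1,2)] topological_dualD(1)[OF assms(1)])
qed (simp_all add: topological_dual_zero[OF assms(1,2)])

text \<open>If \<open>f\<close> vanishes at the points that define a neighbourhood of zero on which \<open>\<phi>\<close> is bounded,
  then all multiples of \<open>f\<close> lie in it, and so \<open>\<phi> f\<close> has to be zero.\<close>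

lemma finite_determining_set:
  fixes M :: "('a \<Rightarrow> 'k::real_normed_field) set"
  assumes \<phi>: "\<phi> \<in> topological_dual fun_scale (pointwise_topology M)"
    and M: "fun_scale.subspace M"
  obtains F where "finite F" "determining_set M \<phi> F"
proof -
  let ?U = "{f \<in> topspace (pointwise_topology M). \<phi> f \<in> ball 0 1}"
  have "openin (pointwise_topology M) ?U"
    by (rule openin_continuous_map_preimage[OF topological_dualD(3)[OF \<phi>]]) simp
  moreover have "0 \<in> ?U"
    using topological_dual_zero[OF \<phi> M] fun_scale.subspace_0[OF M] by simp
  ultimately obtain F e where F: "finite F" "e > 0"
      "\<And>f. f \<in> M \<Longrightarrow> (\<And>x. x \<in> F \<Longrightarrow> norm (f x) < e) \<Longrightarrow> f \<in> ?U"
    by (rule pointwise_zero_neighbourhood) blast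
  have "\<phi> f = 0" if f: "f \<in> M" "\<forall>x\<in>F. f x = 0" for f
  proof (rule ccontr)
    assume "\<phi> f \<noteq> 0"
    let ?g = "fun_scale (inverse (\<phi> f)) f"
    have "?g \<in> M"
      by (rule fun_scale.subspace_scale[OF M f(1)])
    then have "?g \<in> ?U"
      by (rule F(3)) (use f(2) F(2) in \<open>simp add: fun_scale_def\<close>)
    moreover have "\<phi> ?g = 1"
      using topological_dualD(2)[OF \<phi> f(1)] \<open>\<phi> f \<noteq> 0\<close> by simp
    ultimately show False
      by simp
  qed
  with F(1) show thesis
    by (intro that) (auto simp: determining_set_def)
qed

text \<open>A smallest determining set is a support: a function that detects \<open>\<phi>\<close> but vanishes on the
  rest of the set shows that, for functions vanishing on the rest, \<open>\<phi>\<close> is a nonzero multiple of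
  the evaluation at \<open>x\<close>.\<close>

lemma exists_support:
  fixes M :: "('a \<Rightarrow> 'k::real_normed_field) set"
  assumes \<phi>: "\<phi> \<in> topological_dual fun_scale (pointwise_topology M)"
    and M: "fun_scale.subspace M" "M \<subseteq> scalar_functions X"
  obtains F where "finite F" "F \<subseteq> topspace X" "determining_set M \<phi> F"
    "\<And>x h. x \<in> F \<Longrightarrow> h \<in> M \<Longrightarrow> h x \<noteq> 0 \<Longrightarrow> (\<And>y. y \<in> F - {x} \<Longrightarrow> h y = 0) \<Longrightarrow> \<phi> h \<noteq> 0"
proof -
  obtain F where F: "finite F" "determining_set M \<phi> F"
    and least: "\<And>G. finite G \<Longrightarrow> determining_set M \<phi> G \<Longrightarrow> card F \<le> card G"
    using exists_least_iff[of "\<lambda>n. \<exists>F. finite F \<and> determining_set M \<phi> F \<and> card F = n"]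
      finite_determining_set[OF \<phi> M(1)] by (metis not_le)
  have detect: "\<exists>f\<in>M. (\<forall>y\<in>F - {x}. f y = 0) \<and> \<phi> f \<noteq> 0" if "x \<in> F" for x
  proof -
    have "card (F - {x}) < card F"
      using F(1) that by (rule card_Diff1_less)
    then have "\<not> determining_set M \<phi> (F - {x})"
      using least F(1) by (meson finite_Diff not_le)
    then show ?thesis
      unfolding determining_set_def by blast
  qed
  have vanish: "\<phi> f = 0" if "f \<in> M" "\<forall>y\<in>F. f y = 0" for f
    using F(2) that by (simp add: determining_set_def)
  have "x \<in> topspace X" if "x \<in> F" for x
  proof (rule ccontr)
    assume "x \<notin> topspace X"
    moreover obtain f where f: "f \<in> M" "\<forall>y\<in>F - {x}. f y = 0" "\<phi> f \<noteq> 0"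
      using detect[OF \<open>x \<in> F\<close>] by blast
    ultimately have "\<forall>y\<in>F. f y = 0"
      using M(2) by (force simp: scalar_functions_def)
    with f vanish show False
      by blast
  qed
  moreover have "\<phi> h \<noteq> 0"
    if x: "x \<in> F" and h: "h \<in> M" "h x \<noteq> 0" "\<And>y. y \<in> F - {x} \<Longrightarrow> h y = 0" for x h
  proof
    assume "\<phi> h = 0"
    obtain f where f: "f \<in> M" "\<forall>y\<in>F - {x}. f y = 0" "\<phi> f \<noteq> 0"
      using detect[OF x] by blast
    let ?h = "fun_scale (f x / h x) h"
    have h': "?h \<in> M"
      by (rule fun_scale.subspace_scale[OF M(1) h(1)])
    have "\<phi> (f - ?h) = 0"
    proof (rule vanish)
      show "f - ?h \<in> M"
        by (rule fun_scale.subspace_diff[OF M(1) f(1) h'])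
      show "\<forall>y\<in>F. (f - ?h) y = 0"
      proof
        fix y assume "y \<in> F"
        then show "(f - ?h) y = 0"
          using f(2) h(2,3) by (cases "y = x") (simp_all add: fun_scale_def)
      qed
    qed
    then have "\<phi> f = \<phi> ?h"
      using topological_dual_diff[OF \<phi> M(1) f(1) h'] by simp
    also have "\<dots> = 0"
      using topological_dualD(2)[OF \<phi> h(1)] \<open>\<phi> h = 0\<close> by simp
    finally show False
      using f(3) by simp
  qed
  ultimately show thesis
    using F by (intro that[of F]) auto
qed

section \<open>Sets of functionals with a common finite support\<close>

text \<open>Given finitely many continuous functions \<open>h\<^sub>x\<close> with value \<open>1\<close> at \<open>x\<close> and \<open>0\<close> at the other
  points of \<open>S\<close>, a functional determined by \<open>S\<close> is the finite sum \<open>\<phi>(f) = \<Sum>\<^sub>x f(x) \<phi>(h\<^sub>x)\<close>. Pointwise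
  boundedness on the \<open>h\<^sub>x\<close> thus bounds all coefficients at once, and a bound on the values of
  \<open>f\<close> on \<open>S\<close> defines a neighbourhood of zero.\<close>

lemma equicontinuous_if_common_determining_set:
  fixes M :: "('a \<Rightarrow> 'k::real_normed_field) set"
  assumes X: "tychonoff_space X"
    and M: "fun_scale.subspace M" "continuous_functions X \<subseteq> M"
    and B: "B \<subseteq> topological_dual fun_scale (pointwise_topology M)"
    and bdd: "\<And>f. f \<in> M \<Longrightarrow> bdd_above ((\<lambda>\<phi>. norm (\<phi> f)) ` B)"
    and S: "finite S" "S \<subseteq> topspace X" "\<And>\<phi>. \<phi> \<in> B \<Longrightarrow> determining_set M \<phi> S"
  shows "equicontinuous fun_scale (pointwise_topology M) B"
proof -
  have "\<exists>h. h \<in> M \<and> h x = 1 \<and> (\<forall>y\<in>S - {x}. h y = 0)" if "x \<in> S" for x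
  proof -
    obtain h :: "'a \<Rightarrow> 'k" where "h \<in> continuous_functions X" "h x = 1" "\<And>y. y \<in> S - {x} \<Longrightarrow> h y = 0"
      by (rule tychonoff_bump_finite[OF X, of "S - {x}" x]) (use S(1,2) \<open>x \<in> S\<close> in auto)
    with M(2) show ?thesis
      by blast
  qed
  then obtain h where h: "\<And>x. x \<in> S \<Longrightarrow> h x \<in> M" "\<And>x. x \<in> S \<Longrightarrow> h x x = 1"
      "\<And>x y. x \<in> S \<Longrightarrow> y \<in> S \<Longrightarrow> y \<noteq> x \<Longrightarrow> h x y = 0"
    by (metis DiffI empty_iff insert_iff)
  obtain C where C: "\<And>x \<phi>. x \<in> S \<Longrightarrow> \<phi> \<in> B \<Longrightarrow> norm (\<phi> (h x)) \<le> C x"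
    using bdd[OF h(1)] unfolding bdd_above_def by (metis imageI)
  define K where "K = 1 + (\<Sum>x\<in>S. \<bar>C x\<bar>)"
  have K: "K > 0"
    unfolding K_def by (intro add_pos_nonneg sum_nonneg) auto
  define U where "U = {f \<in> M. \<forall>x\<in>S. norm (f x) < 1 / K}"
  have U: "openin (pointwise_topology M) U" "0 \<in> U"
    using openin_pointwise_basic[OF S(1)] K fun_scale.subspace_0[OF M(1)] by (auto simp: U_def)
  have "norm (\<phi> f) \<le> 1" if \<phi>: "\<phi> \<in> B" and f: "f \<in> U" for \<phi> f
  proof -
    have dual: "\<phi> \<in> topological_dual fun_scale (pointwise_topology M)"
      using B \<phi> by blast
    have fM: "f \<in> M" and less: "\<And>x. x \<in> S \<Longrightarrow> norm (f x) < 1 / K"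
      using f by (auto simp: U_def)
    \<comment> \<open>The continuous function that interpolates \<open>f\<close> on \<open>S\<close>.\<close>
    let ?g = "\<Sum>x\<in>S. fun_scale (f x) (h x)"
    have hM: "fun_scale (f x) (h x) \<in> M" if "x \<in> S" for x
      using h(1)[OF that] by (rule fun_scale.subspace_scale[OF M(1)])
    then have gM: "?g \<in> M"
      by (rule fun_scale.subspace_sum[OF M(1)])
    have "?g y = f y" if "y \<in> S" for y
    proof -
      have "?g y = (\<Sum>x\<in>S. f x * h x y)"
        by (induction S rule: infinite_finite_induct) (simp_all add: fun_scale_def)
      also have "\<dots> = (\<Sum>x\<in>S. if x = y then f x else 0)"
        by (rule sum.cong) (use h(2,3) that in auto)
      finally show ?thesis
        using S(1) that by simp
    qed
    then have "\<phi> (f - ?g) = 0"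
      using S(3)[OF \<phi>] fun_scale.subspace_diff[OF M(1) fM gM]
      by (simp add: determining_set_def)
    then have "\<phi> f = \<phi> ?g"
      using topological_dual_diff[OF dual M(1) fM gM] by simp
    also have "\<dots> = (\<Sum>x\<in>S. \<phi> (fun_scale (f x) (h x)))"
      using hM by (rule topological_dual_sum[OF dual M(1)])
    also have "\<dots> = (\<Sum>x\<in>S. f x * \<phi> (h x))"
      by (rule sum.cong) (simp_all add: topological_dualD(2)[OF dual h(1)])
    also have "norm \<dots> \<le> (\<Sum>x\<in>S. 1 / K * \<bar>C x\<bar>)"
    proof (rule sum_norm_le)
      fix x assume x: "x \<in> S"
      have "norm (\<phi> (h x)) \<le> \<bar>C x\<bar>"
        using C[OF x \<phi>] by simp
      then show "norm (f x * \<phi> (h x)) \<le> 1 / K * \<bar>C x\<bar>"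
        unfolding norm_mult using less[OF x] K by (intro mult_mono) auto
    qed
    also have "\<dots> = (K - 1) / K"
      by (simp add: K_def sum_divide_distrib)
    also have "\<dots> \<le> 1"
      using K by (simp add: field_simps)
    finally show ?thesis .
  qed
  then have "B \<subseteq> polar fun_scale (pointwise_topology M) U"
    using B by (auto simp: polar_def)
  then show ?thesis
    unfolding equicontinuous_def using U
    by (intro exI[of _ U] conjI exI[of _ U]) (auto simp: U_def)
qed

section \<open>Barrelledness of spaces containing the continuous functions\<close>

lemma eventually_zero_in_lp_c0:
  assumes "\<forall>\<^sub>F n in sequentially. a n = 0"
  shows "a \<in> lp_c0 p"
proof -
  have "a \<longlonglongrightarrow> 0"
    using assms by (rule tendsto_eventually)
  moreover have "\<forall>\<^sub>F n in sequentially. norm (a n) powr enn2real p = 0"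
    using assms by eventually_elim simp
  then have "summable (\<lambda>n. norm (a n) powr enn2real p)"
    using summable_cong[of "\<lambda>n. norm (a n) powr enn2real p" "\<lambda>_. 0 :: real"] by simp
  ultimately show ?thesis
    by (simp add: lp_c0_def)
qed

lemma not_in_lp_c0_if_ge_1:
  fixes a :: "nat \<Rightarrow> real"
  assumes "\<And>n. a n \<ge> 1"
  shows "a \<notin> lp_c0 q"
proof
  assume a: "a \<in> lp_c0 q"
  have "\<exists>b. b \<longlonglongrightarrow> 0 \<and> (\<forall>n. b n \<ge> (1::real))"
  proof (cases "q = \<infinity>")
    case True
    with a assms show ?thesis
      by (auto simp: lp_c0_def)
  next
    case False
    have "norm (a n) powr enn2real q \<ge> 1" for n
      using assms[of n] by (intro ge_one_powr_ge_zero) auto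
    with a False show ?thesis
      by (auto simp: lp_c0_def dest!: summable_LIMSEQ_zero)
  qed
  then show False
    by (metis LIMSEQ_le_const not_one_le_zero)
qed

text \<open>Each of the finitely many points that determine a functional lies in the carrier of at most
  one of the functions.\<close>

lemma weakly_summable_disjoint_carriers:
  fixes M :: "('a \<Rightarrow> 'k::real_normed_field) set"
  assumes M: "fun_scale.subspace M"
    and h: "\<And>n. h n \<in> M" "disjoint_family V" "\<And>n y. y \<notin> V n \<Longrightarrow> h n y = 0"
  shows "weakly_summable fun_scale (pointwise_topology M) p h"
  unfolding weakly_summable_def
proof (intro conjI ballI)
  show "range h \<subseteq> topspace (pointwise_topology M)"
    using h(1) by auto
  fix \<phi> assume "\<phi> \<in> topological_dual fun_scale (pointwise_topology M)"
  then obtain F where F: "finite F" "determining_set M \<phi> F"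
    using M by (rule finite_determining_set)
  have "\<forall>\<^sub>F n in sequentially. \<forall>y\<in>F. h n y = 0"
  proof (rule eventually_ball_finite[OF F(1)], rule ballI)
    fix y
    have "\<exists>m. \<forall>n>m. y \<notin> V n"
    proof (cases "\<exists>m. y \<in> V m")
      case True
      then obtain m where "y \<in> V m"
        by blast
      then have "y \<notin> V n" if "n > m" for n
        using disjoint_family_onD[OF h(2), of m n] that by auto
      then show ?thesis
        by blast
    qed simp
    then show "\<forall>\<^sub>F n in sequentially. h n y = 0"
      unfolding eventually_at_top_dense using h(3) by blast
  qed
  then have "\<forall>\<^sub>F n in sequentially. \<phi> (h n) = 0"
    by eventually_elim (use F(2) h(1) in \<open>simp add: determining_set_def\<close>)
  then show "(\<lambda>n. \<phi> (h n)) \<in> lp_c0 p"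
    by (rule eventually_zero_in_lp_c0)
qed

theorem V_barrelled_pointwise_topology:
  fixes M :: "('a \<Rightarrow> 'k::real_normed_field) set"
  assumes X: "tychonoff_space X"
    and M: "fun_scale.subspace M" "continuous_functions X \<subseteq> M" "M \<subseteq> scalar_functions X"
  shows "V_barrelled fun_scale (pointwise_topology M) p q"
  unfolding V_barrelled_def
proof (intro allI impI)
  let ?T = "pointwise_topology M"
  fix B assume "V_set fun_scale ?T p q B"
  then have B: "B \<subseteq> topological_dual fun_scale ?T"
    and V: "\<And>x. weakly_summable fun_scale ?T p x \<Longrightarrow>
        (\<forall>n. bdd_above ((\<lambda>\<phi>. norm (\<phi> (x n))) ` B)) \<and> (\<lambda>n. SUP \<phi>\<in>B. norm (\<phi> (x n))) \<in> lp_c0 q"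
    by (auto simp: V_set_def)
  \<comment> \<open>A sequence with a single nonzero term is weakly summable, so the condition on \<open>B\<close> includes
    pointwise boundedness.\<close>
  have bdd: "bdd_above ((\<lambda>\<phi>. norm (\<phi> f)) ` B)" if f: "f \<in> M" for f
  proof -
    let ?x = "\<lambda>n::nat. if n = 0 then f else 0"
    have "weakly_summable fun_scale ?T p ?x"
      unfolding weakly_summable_def
    proof (intro conjI ballI)
      show "range ?x \<subseteq> topspace ?T"
        using f fun_scale.subspace_0[OF M(1)] by auto
      fix \<phi> assume "\<phi> \<in> topological_dual fun_scale ?T"
      then have "\<forall>\<^sub>F n in sequentially. \<phi> (?x n) = 0"
        using topological_dual_zero[OF _ M(1)]
        by (intro eventually_mono[OF eventually_gt_at_top[of 0]]) simp
      then show "(\<lambda>n. \<phi> (?x n)) \<in> lp_c0 p"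
        by (rule eventually_zero_in_lp_c0)
    qed
    then have "bdd_above ((\<lambda>\<phi>. norm (\<phi> (?x 0))) ` B)"
      by (rule V[THEN conjunct1, rule_format])
    then show ?thesis
      by simp
  qed
  have "\<forall>\<phi>\<in>B. \<exists>F. finite F \<and> F \<subseteq> topspace X \<and> determining_set M \<phi> F \<and>
      (\<forall>x\<in>F. \<forall>h\<in>M. h x \<noteq> 0 \<longrightarrow> (\<forall>y\<in>F - {x}. h y = 0) \<longrightarrow> \<phi> h \<noteq> 0)"
  proof
    fix \<phi> assume "\<phi> \<in> B"
    with B have "\<phi> \<in> topological_dual fun_scale ?T"
      by blast
    then obtain F where "finite F" "F \<subseteq> topspace X" "determining_set M \<phi> F"
        "\<And>x h. x \<in> F \<Longrightarrow> h \<in> M \<Longrightarrow> h x \<noteq> 0 \<Longrightarrow> (\<And>y. y \<in> F - {x} \<Longrightarrow> h y = 0) \<Longrightarrow> \<phi> h \<noteq> 0"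
      using exists_support[OF _ M(1,3)] by blast
    then show "\<exists>F. finite F \<and> F \<subseteq> topspace X \<and> determining_set M \<phi> F \<and>
        (\<forall>x\<in>F. \<forall>h\<in>M. h x \<noteq> 0 \<longrightarrow> (\<forall>y\<in>F - {x}. h y = 0) \<longrightarrow> \<phi> h \<noteq> 0)"
      by (intro exI[of _ F]) simp
  qed
  from bchoice[OF this] obtain supp where "\<forall>\<phi>\<in>B. finite (supp \<phi>) \<and> supp \<phi> \<subseteq> topspace X \<and>
      determining_set M \<phi> (supp \<phi>) \<and>
      (\<forall>x\<in>supp \<phi>. \<forall>h\<in>M. h x \<noteq> 0 \<longrightarrow> (\<forall>y\<in>supp \<phi> - {x}. h y = 0) \<longrightarrow> \<phi> h \<noteq> 0)" ..
  then have supp: "\<And>\<phi>. \<phi> \<in> B \<Longrightarrow> finite (supp \<phi>)" "\<And>\<phi>. \<phi> \<in> B \<Longrightarrow> supp \<phi> \<subseteq> topspace X"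
      "\<And>\<phi>. \<phi> \<in> B \<Longrightarrow> determining_set M \<phi> (supp \<phi>)"
      "\<And>\<phi> x h. \<phi> \<in> B \<Longrightarrow> x \<in> supp \<phi> \<Longrightarrow> h \<in> M \<Longrightarrow> h x \<noteq> 0 \<Longrightarrow> (\<forall>y\<in>supp \<phi> - {x}. h y = 0) \<Longrightarrow>
        \<phi> h \<noteq> 0"
    by simp_all
  define S where "S = (\<Union>\<phi>\<in>B. supp \<phi>)"
  have SX: "S \<subseteq> topspace X"
    using supp(2) by (auto simp: S_def)
  have finS: "finite S"
  proof (rule ccontr)
    assume "infinite S"
    then obtain z W where z: "\<And>n::nat. z n \<in> S" "\<And>n. z n \<in> W n" "\<And>n. openin X (W n)"
        "disjoint_family W"
      by (rule tychonoff_disjoint_neighbourhoods[OF X _ SX]) (rule that)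
    have "\<exists>h \<phi>. h \<in> M \<and> (\<forall>y. y \<notin> W n \<longrightarrow> h y = 0) \<and> \<phi> \<in> B \<and> \<phi> h = 1" for n
    proof -
      obtain \<phi> where \<phi>: "\<phi> \<in> B" "z n \<in> supp \<phi>"
        using z(1)[of n] by (auto simp: S_def)
      \<comment> \<open>Only the other points of the support of the one functional \<open>\<phi>\<close> have to be avoided, so the
        functionals can be chosen after the points and their neighbourhoods.\<close>
      have "openin X (W n - (supp \<phi> - {z n}))"
        by (rule tychonoff_openin_diff_finite[OF X z(3)]) (use supp(1,2)[OF \<phi>(1)] in auto)
      moreover have "z n \<in> W n - (supp \<phi> - {z n})"
        using z(2) by simp
      ultimately obtain g :: "'a \<Rightarrow> 'k" where g: "g \<in> continuous_functions X" "g (z n) = 1"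
          "\<And>y. y \<notin> W n - (supp \<phi> - {z n}) \<Longrightarrow> g y = 0"
        by (rule tychonoff_bump[OF X]) (rule that)
      have gM: "g \<in> M"
        using g(1) M(2) by blast
      have "\<phi> g \<noteq> 0"
        by (rule supp(4)[OF \<phi> gM]) (use g(2,3) in auto)
      then have "\<phi> (fun_scale (inverse (\<phi> g)) g) = 1"
        using topological_dualD(2)[OF subsetD[OF B \<phi>(1)] gM] by simp
      moreover have "fun_scale (inverse (\<phi> g)) g \<in> M"
        by (rule fun_scale.subspace_scale[OF M(1) gM])
      moreover have "\<forall>y. y \<notin> W n \<longrightarrow> fun_scale (inverse (\<phi> g)) g y = 0"
        using g(3) by (simp add: fun_scale_def)
      ultimately show ?thesis
        using \<phi>(1) by blast
    qed
    then obtain h \<phi> where h: "\<And>n. h n \<in> M" "\<And>n y. y \<notin> W n \<Longrightarrow> h n y = 0"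
        "\<And>n. \<phi> n \<in> B" "\<And>n. \<phi> n (h n) = 1"
      by metis
    have "weakly_summable fun_scale ?T p h"
      by (rule weakly_summable_disjoint_carriers[OF M(1) h(1) z(4) h(2)])
    then have sup: "\<And>n. bdd_above ((\<lambda>\<phi>. norm (\<phi> (h n))) ` B)"
        "(\<lambda>n. SUP \<phi>\<in>B. norm (\<phi> (h n))) \<in> lp_c0 q"
      by (simp_all add: V)
    have "1 \<le> (SUP \<phi>\<in>B. norm (\<phi> (h n)))" for n
      by (rule cSUP_upper2[OF sup(1) h(3)[of n]]) (simp add: h(4))
    then show False
      using not_in_lp_c0_if_ge_1[of "\<lambda>n. SUP \<phi>\<in>B. norm (\<phi> (h n))"] sup(2) by blast
  qed
  have det: "determining_set M \<phi> S" if "\<phi> \<in> B" for \<phi>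
    using supp(3)[OF that] that by (auto simp: determining_set_def S_def)
  show "equicontinuous fun_scale ?T B"
    by (rule equicontinuous_if_common_determining_set[OF X M(1,2) B bdd finS SX det])
qed

lemma continuous_functions_subset_baire_functions:
  assumes "Well_order \<alpha>"
  shows "continuous_functions X \<subseteq> baire_functions X \<alpha>"
proof (cases "\<alpha> = {}")
  case True
  then show ?thesis
    by (simp add: baire_functions.simps)
next
  case False
  then have "baire_functions X {} \<subseteq> baire_functions X \<alpha>"
    using empty_ordLess[OF assms] ordLess_imp_ordLeq baire_functions_mono by blast
  then show ?thesis
    by (simp add: baire_functions.simps)
qed

lemma baire_functions_subset_scalar_functions: "baire_functions X \<alpha> \<subseteq> scalar_functions X"
  by (subst baire_functions.simps) (auto simp: continuous_functions_def)

section \<open>Functionally bounded sets\<close>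

lemma not_c0_barrelled_if_functionally_bounded:
  assumes X: "tychonoff_space X"
    and A: "infinite A" "functionally_bounded TYPE('k::real_normed_field) X A"
  shows "\<not> c0_barrelled fun_scale (Cp X :: ('a \<Rightarrow> 'k) topology)"
proof
  let ?M = "continuous_functions X :: ('a \<Rightarrow> 'k) set"
  let ?T = "Cp X :: ('a \<Rightarrow> 'k) topology"
  assume c0: "c0_barrelled fun_scale ?T"
  have T: "?T = pointwise_topology ?M" "topspace ?T = ?M"
    by (simp_all add: Cp_def)
  obtain a :: "nat \<Rightarrow> 'a" where a: "inj a" "range a \<subseteq> A"
    using A(1) infinite_countable_subset by blast
  have aX: "a n \<in> topspace X" for n
    using a(2) A(2) by (auto simp: functionally_bounded_def)
  define \<phi> :: "nat \<Rightarrow> ('a \<Rightarrow> 'k) \<Rightarrow> 'k"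
    where "\<phi> n = restrict (\<lambda>f. of_real (inverse (Suc n)) * f (a n)) ?M" for n
  have \<phi>_eq: "\<phi> n f = of_real (inverse (Suc n)) * f (a n)" if "f \<in> ?M" for n f
    using that by (simp add: \<phi>_def)
  have dual: "\<phi> n \<in> topological_dual fun_scale ?T" for n
  proof -
    have "continuous_map ?T euclidean (\<lambda>f. of_real (inverse (Suc n)) * f (a n) :: 'k)"
      unfolding T(1) by (intro continuous_map_mult_scalar continuous_map_pointwise_eval) simp
    then have "continuous_map ?T euclidean (\<phi> n)"
      by (rule continuous_map_eq) (simp add: T(2) \<phi>_eq)
    moreover have "\<phi> n (f + g) = \<phi> n f + \<phi> n g" if "f \<in> ?M" "g \<in> ?M" for f g
      using that fun_scale.subspace_add[OF subspace_continuous_functions that]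
      by (simp add: \<phi>_eq distrib_left)
    moreover have "\<phi> n (fun_scale c f) = c * \<phi> n f" if "f \<in> ?M" for c f
      using fun_scale.subspace_scale[OF subspace_continuous_functions that] that
      by (simp add: \<phi>_eq) (simp add: fun_scale_def)
    moreover have "\<phi> n \<in> extensional ?M"
      by (simp add: \<phi>_def)
    ultimately show ?thesis
      by (simp add: topological_dual_def T(2))
  qed
  have zero: "restrict (\<lambda>_. 0) ?M \<in> topological_dual fun_scale ?T"
  proof -
    have "continuous_map ?T euclidean (restrict (\<lambda>_. 0 :: 'k) ?M)"
      by (rule continuous_map_eq[of _ _ "\<lambda>_. 0"]) (simp_all add: T(2))
    then show ?thesis
      using fun_scale.subspace_add[OF subspace_continuous_functions[of X]]
        fun_scale.subspace_scale[OF subspace_continuous_functions[of X]]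
      by (auto simp: topological_dual_def T(2))
  qed
  have lim: "(\<lambda>n. \<phi> n f) \<longlonglongrightarrow> 0" if f: "f \<in> ?M" for f
  proof -
    have "bounded (f ` A)"
      using A(2) f by (auto simp: functionally_bounded_def continuous_functions_def)
    then obtain K where "\<And>n. norm (f (a n)) \<le> K"
      using a(2) unfolding bounded_iff by blast
    then have "norm (\<phi> n f) \<le> inverse (real (Suc n)) * K" for n
      unfolding \<phi>_eq[OF f] norm_mult norm_of_real
      by (intro mult_mono) auto
    moreover have "(\<lambda>n. inverse (real (Suc n)) * K) \<longlonglongrightarrow> 0"
      using tendsto_mult_left_zero[OF LIMSEQ_inverse_real_of_nat] .
    ultimately show ?thesis
      by (rule Lim_null_comparison[OF always_eventually[OF allI]])
  qed
  have "limitin (weak_star_topology fun_scale ?T) \<phi> (restrict (\<lambda>_. 0) (topspace ?T)) sequentially"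
    unfolding weak_star_topology_def limitin_subtopology limitin_componentwise T(2)
  proof (intro conjI ballI always_eventually allI)
    show "\<phi> n \<in> topspace (product_topology (\<lambda>_. euclidean) ?M)" for n
      by (simp add: \<phi>_def PiE_iff)
    show "limitin euclidean (\<lambda>n. \<phi> n f) (restrict (\<lambda>_. 0) ?M f) sequentially" if "f \<in> ?M" for f
      using lim[OF that] that by simp
  qed (simp_all add: dual zero)
  then have "equicontinuous fun_scale ?T (range \<phi>)"
    using c0 dual unfolding c0_barrelled_def by blast
  then obtain U W where U: "openin (pointwise_topology ?M) W" "0 \<in> W" "W \<subseteq> U"
      "range \<phi> \<subseteq> polar fun_scale ?T U"
    unfolding equicontinuous_def T(1) by blast
  obtain F e where F: "finite F" "e > 0"
      "\<And>f. f \<in> ?M \<Longrightarrow> (\<And>x. x \<in> F \<Longrightarrow> norm (f x) < e) \<Longrightarrow> f \<in> W"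
    using pointwise_zero_neighbourhood[OF U(1,2)] by blast
  obtain n where n: "a n \<notin> F"
    using finite_subset[OF _ F(1), of "range a"] range_inj_infinite[OF a(1)] by blast
  \<comment> \<open>A function that vanishes on \<open>F\<close> lies in \<open>W\<close> however large it is at \<open>a n\<close>.\<close>
  obtain g :: "'a \<Rightarrow> 'k" where g: "g \<in> ?M" "g (a n) = 1" "\<And>y. y \<in> F \<inter> topspace X \<Longrightarrow> g y = 0"
    by (rule tychonoff_bump_finite[OF X, of "F \<inter> topspace X" "a n"]) (use F(1) n aX in auto)
  \<comment> \<open>The factor makes the value of \<open>\<phi> n\<close> equal to \<open>2\<close>.\<close>
  let ?f = "fun_scale (of_nat (2 * Suc n)) g"
  have f: "?f \<in> ?M"
    by (rule fun_scale.subspace_scale[OF subspace_continuous_functions g(1)])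
  have "?f \<in> W"
  proof (rule F(3)[OF f])
    fix x assume "x \<in> F"
    then have "g x = 0"
      using g(1,3) by (cases "x \<in> topspace X") (auto simp: continuous_functions_def scalar_functions_def)
    then show "norm (?f x) < e"
      using F(2) by (simp add: fun_scale_def)
  qed
  then have "norm (\<phi> n ?f) \<le> 1"
    using U(3,4) unfolding polar_def by blast
  moreover have "\<phi> n ?f = of_real (inverse (real (Suc n)) * real (2 * Suc n))"
    unfolding \<phi>_eq[OF f] using g(2) by (simp only: fun_scale_def of_real_mult of_real_of_nat_eq mult_1_right)
  then have "norm (\<phi> n ?f) = 2"
    by (simp only: norm_of_real) (simp add: field_simps)
  ultimately show False
    by simp
qed

section \<open>Barrelledness of the function spaces\<close>

theorem corollary9p5:
  fixes p q :: ennreal and \<alpha> :: "nat rel" and X :: "'a topology"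
  assumes "1 \<le> p" and "p \<le> q"
    and "Well_order \<alpha>"
    and "tychonoff_space X"
  shows "V_barrelled fun_scale (Cp X :: ('a \<Rightarrow> 'k::real_normed_field) topology) p q \<and>
    V_barrelled fun_scale (Baire X \<alpha> :: ('a \<Rightarrow> 'k) topology) p q \<and>
    ((\<exists>A. infinite A \<and> functionally_bounded TYPE('k) X A) \<longrightarrow>
      V_barrelled fun_scale (Cp X :: ('a \<Rightarrow> 'k) topology) p q \<and>
      \<not> c0_barrelled fun_scale (Cp X :: ('a \<Rightarrow> 'k) topology))"
proof -
  have "V_barrelled fun_scale (Cp X :: ('a \<Rightarrow> 'k) topology) p q"
    unfolding Cp_def
    by (rule V_barrelled_pointwise_topology[OF assms(4) subspace_continuous_functions order_refl])
      (auto simp: continuous_functions_def)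
  moreover have "V_barrelled fun_scale (Baire X \<alpha> :: ('a \<Rightarrow> 'k) topology) p q"
    unfolding Baire_def
    by (rule V_barrelled_pointwise_topology[OF assms(4) subspace_baire_functions[OF assms(3)]
          continuous_functions_subset_baire_functions[OF assms(3)]
          baire_functions_subset_scalar_functions])
  ultimately show ?thesis
    using not_c0_barrelled_if_functionally_bounded[OF assms(4)] by blast
qed

end
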